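(* Let $\mathcal{B}$ be a finite structure with domain $B$. The following are equivalent. (i) There is $x\in B$ such that $\mathcal{B}$ is $0$-collapsible from source $\{x\}$ for equality-free pH-sentences. (ii) $\mathcal{B}$ admits a simple $A$-she. (iii) There is $x\in B$ such that $\mathcal{B}$ is $0$-collapsible from source $\{x\}$ for sentences of positive equality-free first-order logic.
   Context: $\mathcal{B}$ is a finite relational structure. An equality-free pH-sentence is a prenex first-order sentence built from relational atoms (no equality) using only $\exists,\forall,\wedge$. A sentence of positive equality-free first-order logic is built from relational atoms (no equality) using only $\exists,\forall,\wedge,\vee$. For a class of sentences, $\mathcal{B}$ is $0$-collapsible from source $\{x\}$ if for every sentence $\phi$ of the class, $\mathcal{B}\models\phi$ if and only if $\mathcal{B}$ satisfies $\phi$ when every universal quantifier is relativised to $\{x\}$ (i.e. universally quantified variables range only over $\{x\}$). A shop on $B$ is a map $f$ from $B$ to the power set of $B$ with $f(y)\neq\emptyset$ for all $y$ and such that every $b\in B$ lies in $f(y)$ for some $y$. It is an $A$-shop if $f(x)=B$ for some $x$, and a simple $A$-shop if moreover $|f(x')|=1$ for every $x'\neq x$. A shop $f$ is a she (surjective hyper-endomorphism) of $\mathcal{B}$ if for every relation $R$ of arity $r$ and $(a_1,\dots,a_r)\in R^{\mathcal{B}}$, every $(b_1,\dots,b_r)$ with $b_i\in f(a_i)$ is in $R^{\mathcal{B}}$. $\mathcal{B}$ admits a simple $A$-she if some simple $A$-shop is a she of $\mathcal{B}$. *)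

theory Defs
  imports Main
begin

record ('r, 'a) rel_struct =
  universe :: "'a set"
  symbols :: "'r set"
  arity :: "'r \<Rightarrow> nat"
  interp :: "'r \<Rightarrow> 'a list set"

definition finite_structure :: "('r, 'a) rel_struct \<Rightarrow> bool" where
  "finite_structure \<B> \<longleftrightarrow>
     finite (universe \<B>) \<and>
     (\<forall>R\<in>symbols \<B>. \<forall>as\<in>interp \<B> R. length as = arity \<B> R \<and> set as \<subseteq> universe \<B>)"

text \<open>Variables are natural numbers; since signatures are relational, they are the only terms.\<close>

datatype 'r fm =
    Atom 'r "nat list"
  | Conj "'r fm" "'r fm"
  | Disj "'r fm" "'r fm"
  | Exi nat "'r fm"
  | Uni nat "'r fm"

primrec free_vars :: "'r fm \<Rightarrow> nat set" where
  "free_vars (Atom R vs) = set vs"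
| "free_vars (Conj \<phi> \<psi>) = free_vars \<phi> \<union> free_vars \<psi>"
| "free_vars (Disj \<phi> \<psi>) = free_vars \<phi> \<union> free_vars \<psi>"
| "free_vars (Exi v \<phi>) = free_vars \<phi> - {v}"
| "free_vars (Uni v \<phi>) = free_vars \<phi> - {v}"

primrec over_signature :: "('r, 'a) rel_struct \<Rightarrow> 'r fm \<Rightarrow> bool" where
  "over_signature \<B> (Atom R vs) \<longleftrightarrow> R \<in> symbols \<B> \<and> length vs = arity \<B> R"
| "over_signature \<B> (Conj \<phi> \<psi>) \<longleftrightarrow> over_signature \<B> \<phi> \<and> over_signature \<B> \<psi>"
| "over_signature \<B> (Disj \<phi> \<psi>) \<longleftrightarrow> over_signature \<B> \<phi> \<and> over_signature \<B> \<psi>"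
| "over_signature \<B> (Exi v \<phi>) \<longleftrightarrow> over_signature \<B> \<phi>"
| "over_signature \<B> (Uni v \<phi>) \<longleftrightarrow> over_signature \<B> \<phi>"

definition positive_eqfree_sentences :: "('r, 'a) rel_struct \<Rightarrow> 'r fm set" where
  "positive_eqfree_sentences \<B> = {\<phi>. over_signature \<B> \<phi> \<and> free_vars \<phi> = {}}"

fun conj_of_atoms :: "'r fm \<Rightarrow> bool" where
  "conj_of_atoms (Atom R vs) \<longleftrightarrow> True"
| "conj_of_atoms (Conj \<phi> \<psi>) \<longleftrightarrow> conj_of_atoms \<phi> \<and> conj_of_atoms \<psi>"
| "conj_of_atoms _ \<longleftrightarrow> False"

fun prenex_pH :: "'r fm \<Rightarrow> bool" where
  "prenex_pH (Exi v \<phi>) \<longleftrightarrow> prenex_pH \<phi>"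
| "prenex_pH (Uni v \<phi>) \<longleftrightarrow> prenex_pH \<phi>"
| "prenex_pH \<phi> \<longleftrightarrow> conj_of_atoms \<phi>"

definition eqfree_pH_sentences :: "('r, 'a) rel_struct \<Rightarrow> 'r fm set" where
  "eqfree_pH_sentences \<B> = {\<phi>. over_signature \<B> \<phi> \<and> free_vars \<phi> = {} \<and> prenex_pH \<phi>}"

text \<open>
  Universal quantifiers range over \<open>S\<close>, existential ones over the whole universe; taking
  \<open>S = universe \<B>\<close> gives ordinary Tarskian satisfaction.
\<close>

primrec sat_rel :: "('r, 'a) rel_struct \<Rightarrow> 'a set \<Rightarrow> (nat \<Rightarrow> 'a) \<Rightarrow> 'r fm \<Rightarrow> bool" where
  "sat_rel \<B> S \<sigma> (Atom R vs) \<longleftrightarrow> map \<sigma> vs \<in> interp \<B> R"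
| "sat_rel \<B> S \<sigma> (Conj \<phi> \<psi>) \<longleftrightarrow> sat_rel \<B> S \<sigma> \<phi> \<and> sat_rel \<B> S \<sigma> \<psi>"
| "sat_rel \<B> S \<sigma> (Disj \<phi> \<psi>) \<longleftrightarrow> sat_rel \<B> S \<sigma> \<phi> \<or> sat_rel \<B> S \<sigma> \<psi>"
| "sat_rel \<B> S \<sigma> (Exi v \<phi>) \<longleftrightarrow> (\<exists>a\<in>universe \<B>. sat_rel \<B> S (\<sigma>(v := a)) \<phi>)"
| "sat_rel \<B> S \<sigma> (Uni v \<phi>) \<longleftrightarrow> (\<forall>a\<in>S. sat_rel \<B> S (\<sigma>(v := a)) \<phi>)"

text \<open>Only applied to sentences, where the assignment \<open>\<sigma>\<close> is irrelevant.\<close>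

definition models_rel :: "('r, 'a) rel_struct \<Rightarrow> 'a set \<Rightarrow> 'r fm \<Rightarrow> bool" where
  "models_rel \<B> S \<phi> \<longleftrightarrow> (\<forall>\<sigma>. sat_rel \<B> S \<sigma> \<phi>)"

definition models :: "('r, 'a) rel_struct \<Rightarrow> 'r fm \<Rightarrow> bool" where
  "models \<B> \<phi> \<longleftrightarrow> models_rel \<B> (universe \<B>) \<phi>"

definition zero_collapsible :: "('r, 'a) rel_struct \<Rightarrow> 'a set \<Rightarrow> 'r fm set \<Rightarrow> bool" where
  "zero_collapsible \<B> S \<Phi> \<longleftrightarrow> (\<forall>\<phi>\<in>\<Phi>. models \<B> \<phi> \<longleftrightarrow> models_rel \<B> S \<phi>)"

definition shop :: "'a set \<Rightarrow> ('a \<Rightarrow> 'a set) \<Rightarrow> bool" where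
  "shop B f \<longleftrightarrow> (\<forall>y\<in>B. f y \<subseteq> B \<and> f y \<noteq> {}) \<and> (\<forall>b\<in>B. \<exists>y\<in>B. b \<in> f y)"

definition simple_A_shop :: "'a set \<Rightarrow> ('a \<Rightarrow> 'a set) \<Rightarrow> bool" where
  "simple_A_shop B f \<longleftrightarrow>
     shop B f \<and> (\<exists>x\<in>B. f x = B \<and> (\<forall>x'\<in>B. x' \<noteq> x \<longrightarrow> card (f x') = 1))"

definition she :: "('r, 'a) rel_struct \<Rightarrow> ('a \<Rightarrow> 'a set) \<Rightarrow> bool" where
  "she \<B> f \<longleftrightarrow>
     shop (universe \<B>) f \<and>
     (\<forall>R\<in>symbols \<B>. \<forall>as\<in>interp \<B> R. \<forall>bs.
        list_all2 (\<lambda>a b. b \<in> f a) as bs \<longrightarrow> bs \<in> interp \<B> R)"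

definition admits_simple_A_she :: "('r, 'a) rel_struct \<Rightarrow> bool" where
  "admits_simple_A_she \<B> \<longleftrightarrow> (\<exists>f. simple_A_shop (universe \<B>) f \<and> she \<B> f)"

end

(* (i) ==> (ii): a simple A-shop with f x = B is given by its values g a at the points a other than x.
   If none of the finitely many such g yields a she, each one has a violated fact: some as in R and
   bs in f as with bs not in R. Replace every entry a other than x of as by a variable V a, and every
   entry x by a variable W b, where b is the corresponding entry of bs. The sentence
   "exists V's, for all W's: all these atoms" holds relativised to {x}, by sending V a to a; hence it
   holds in B, and the values of the V's there form a g whose violated fact is not violated. Only one
   atom per g is used, so the signature may be infinite.
   (ii) ==> (iii): by induction on the formula, truth relativised to {x} is carried along the she to
   ordinary truth, as f x = B covers all values of a universally quantified variable. *)
theory Submission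
  imports Defs "HOL-Library.FuncSet"
begin

text \<open>There is no negation, and the range of the existential quantifiers is fixed, so
  shrinking the range of the universal ones can only make a formula easier to satisfy.\<close>

lemma sat_rel_antimono:
  assumes "S \<subseteq> T" "sat_rel \<B> T \<sigma> \<phi>"
  shows "sat_rel \<B> S \<sigma> \<phi>"
  using assms(2) by (induction \<phi> arbitrary: \<sigma>) (use assms(1) in auto)

text \<open>The link between the two assignments is required at free variables only; for a sentence
  it is vacuous, so \<open>\<sigma>\<close> and \<open>\<tau>\<close> are then arbitrary.\<close>

lemma sat_rel_she:
  assumes "she \<B> f" "f x = universe \<B>"
    and "over_signature \<B> \<phi>" "sat_rel \<B> {x} \<sigma> \<phi>" "\<And>v. v \<in> free_vars \<phi> \<Longrightarrow> \<tau> v \<in> f (\<sigma> v)"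
  shows "sat_rel \<B> (universe \<B>) \<tau> \<phi>"
  using assms(3-)
proof (induction \<phi> arbitrary: \<sigma> \<tau>)
  case (Atom R vs)
  then have "list_all2 (\<lambda>a b. b \<in> f a) (map \<sigma> vs) (map \<tau> vs)"
    by (auto simp: list_all2_conv_all_nth)
  with Atom assms(1) show ?case unfolding she_def by auto
next
  case (Conj \<phi> \<psi>)
  then show ?case by (metis UnCI free_vars.simps(2) over_signature.simps(2) sat_rel.simps(2))
next
  case (Disj \<phi> \<psi>)
  then show ?case by (metis UnCI free_vars.simps(3) over_signature.simps(3) sat_rel.simps(3))
next
  case (Exi v \<phi>)
  then obtain a where a: "a \<in> universe \<B>" "sat_rel \<B> {x} (\<sigma>(v := a)) \<phi>" by auto
  with assms(1) obtain b where b: "b \<in> f a" "b \<in> universe \<B>"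
    unfolding she_def shop_def by blast
  have "sat_rel \<B> (universe \<B>) (\<tau>(v := b)) \<phi>"
    by (rule Exi.IH[OF _ a(2)]) (use Exi.prems b in auto)
  with b show ?case by auto
next
  case (Uni v \<phi>)
  have "sat_rel \<B> (universe \<B>) (\<tau>(v := b)) \<phi>" if "b \<in> universe \<B>" for b
  proof (rule Uni.IH)
    \<comment> \<open>The value \<open>x\<close> can stand behind every \<open>b\<close> at once,
      because \<open>f x\<close> is the whole universe.\<close>
    show "sat_rel \<B> {x} (\<sigma>(v := x)) \<phi>" using Uni.prems by simp
  qed (use Uni.prems that assms(2) in auto)
  then show ?case by simp
qed

lemma zero_collapsible_positive_eqfree:
  assumes "she \<B> f" "f x = universe \<B>" "x \<in> universe \<B>"
  shows "zero_collapsible \<B> {x} (positive_eqfree_sentences \<B>)"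
  unfolding zero_collapsible_def models_def models_rel_def positive_eqfree_sentences_def
  using sat_rel_she[OF assms(1,2)] sat_rel_antimono[of "{x}" "universe \<B>" \<B>] assms(3)
  by fastforce

lemma zero_collapsible_subset:
  "zero_collapsible \<B> S \<Psi> \<Longrightarrow> \<Phi> \<subseteq> \<Psi> \<Longrightarrow> zero_collapsible \<B> S \<Phi>"
  unfolding zero_collapsible_def by blast

lemma eqfree_pH_subset_positive_eqfree:
  "eqfree_pH_sentences \<B> \<subseteq> positive_eqfree_sentences \<B>"
  unfolding eqfree_pH_sentences_def positive_eqfree_sentences_def by blast

lemma prenex_pH_if_conj_of_atoms: "conj_of_atoms \<phi> \<Longrightarrow> prenex_pH \<phi>"
  by (cases \<phi>) auto

text \<open>The syntax has no constant for truth, hence the restriction to nonempty sets.\<close>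

lemma exists_finite_conj:
  assumes "finite A" "A \<noteq> {}" "\<And>\<psi>. \<psi> \<in> A \<Longrightarrow> conj_of_atoms \<psi> \<and> over_signature \<B> \<psi>"
  obtains \<phi> where "conj_of_atoms \<phi>" "over_signature \<B> \<phi>" "free_vars \<phi> = \<Union> (free_vars ` A)"
    "\<And>S \<sigma>. sat_rel \<B> S \<sigma> \<phi> \<longleftrightarrow> (\<forall>\<psi>\<in>A. sat_rel \<B> S \<sigma> \<psi>)"
proof -
  have "\<exists>\<phi>. conj_of_atoms \<phi> \<and> over_signature \<B> \<phi> \<and> free_vars \<phi> = \<Union> (free_vars ` A) \<and>
    (\<forall>S \<sigma>. sat_rel \<B> S \<sigma> \<phi> \<longleftrightarrow> (\<forall>\<psi>\<in>A. sat_rel \<B> S \<sigma> \<psi>))"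
    using assms
  proof (induction A rule: finite_ne_induct)
    case (singleton \<psi>)
    then show ?case by (intro exI[of _ \<psi>]) auto
  next
    case (insert \<psi> A)
    then obtain \<phi> where "conj_of_atoms \<phi> \<and> over_signature \<B> \<phi> \<and> free_vars \<phi> = \<Union> (free_vars ` A) \<and>
      (\<forall>S \<sigma>. sat_rel \<B> S \<sigma> \<phi> \<longleftrightarrow> (\<forall>\<psi>\<in>A. sat_rel \<B> S \<sigma> \<psi>))" by auto
    with insert.prems show ?case by (intro exI[of _ "Conj \<psi> \<phi>"]) auto
  qed
  with that show thesis by blast
qed

lemma foldr_Exi [simp]:
  "free_vars (foldr Exi vs \<phi>) = free_vars \<phi> - set vs"
  "over_signature \<B> (foldr Exi vs \<phi>) = over_signature \<B> \<phi>"
  "prenex_pH (foldr Exi vs \<phi>) = prenex_pH \<phi>"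
  by (induction vs) auto

lemma foldr_Uni [simp]:
  "free_vars (foldr Uni vs \<phi>) = free_vars \<phi> - set vs"
  "over_signature \<B> (foldr Uni vs \<phi>) = over_signature \<B> \<phi>"
  "prenex_pH (foldr Uni vs \<phi>) = prenex_pH \<phi>"
  by (induction vs) auto

text \<open>A whole quantifier block becomes one choice of assignment. Repetitions in
  \<open>vs\<close> do no harm: \<open>\<tau>\<close> records only the innermost value of each
  variable.\<close>

lemma sat_rel_foldr_Exi:
  "sat_rel \<B> S \<sigma> (foldr Exi vs \<phi>) \<longleftrightarrow>
    (\<exists>\<tau>. (\<forall>v\<in>set vs. \<tau> v \<in> universe \<B>) \<and> (\<forall>v. v \<notin> set vs \<longrightarrow> \<tau> v = \<sigma> v) \<and> sat_rel \<B> S \<tau> \<phi>)"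
proof (induction vs arbitrary: \<sigma>)
  case Nil
  have "(\<forall>v. \<tau> v = \<sigma> v) \<longleftrightarrow> \<tau> = \<sigma>" for \<tau> by auto
  then show ?case by simp
next
  case (Cons u vs)
  show ?case (is "?l \<longleftrightarrow> ?r")
  proof
    assume ?l
    then obtain a \<tau> where "a \<in> universe \<B>" "\<forall>v\<in>set vs. \<tau> v \<in> universe \<B>"
      "\<forall>v. v \<notin> set vs \<longrightarrow> \<tau> v = (\<sigma>(u := a)) v" "sat_rel \<B> S \<tau> \<phi>"
      by (auto simp: Cons.IH)
    then show ?r by (intro exI[of _ \<tau>]) auto
  next
    assume ?r
    then obtain \<tau> where "\<forall>v\<in>set (u # vs). \<tau> v \<in> universe \<B>"
      "\<forall>v. v \<notin> set (u # vs) \<longrightarrow> \<tau> v = \<sigma> v" "sat_rel \<B> S \<tau> \<phi>" by blast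
    then show ?l by (auto simp: Cons.IH intro!: bexI[of _ "\<tau> u"] exI[of _ \<tau>])
  qed
qed

lemma sat_rel_foldr_Uni:
  "sat_rel \<B> S \<sigma> (foldr Uni vs \<phi>) \<longleftrightarrow>
    (\<forall>\<tau>. (\<forall>v\<in>set vs. \<tau> v \<in> S) \<and> (\<forall>v. v \<notin> set vs \<longrightarrow> \<tau> v = \<sigma> v) \<longrightarrow> sat_rel \<B> S \<tau> \<phi>)"
proof (induction vs arbitrary: \<sigma>)
  case Nil
  have "(\<forall>v. \<tau> v = \<sigma> v) \<longleftrightarrow> \<tau> = \<sigma>" for \<tau> by auto
  then show ?case by simp
next
  case (Cons u vs)
  show ?case (is "?l \<longleftrightarrow> ?r")
  proof
    assume l: ?l
    show ?r
    proof (intro allI impI)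
      fix \<tau> assume "(\<forall>v\<in>set (u # vs). \<tau> v \<in> S) \<and> (\<forall>v. v \<notin> set (u # vs) \<longrightarrow> \<tau> v = \<sigma> v)"
      then have "\<tau> u \<in> S" "\<forall>v\<in>set vs. \<tau> v \<in> S" "\<forall>v. v \<notin> set vs \<longrightarrow> \<tau> v = (\<sigma>(u := \<tau> u)) v" by auto
      moreover from l \<open>\<tau> u \<in> S\<close> have "sat_rel \<B> S (\<sigma>(u := \<tau> u)) (foldr Uni vs \<phi>)" by simp
      ultimately show "sat_rel \<B> S \<tau> \<phi>" unfolding Cons.IH by blast
    qed
  next
    assume r: ?r
    show ?l
    proof (simp add: Cons.IH, intro ballI allI impI)
      fix a \<tau>
      assume a: "a \<in> S" and "(\<forall>v\<in>set vs. \<tau> v \<in> S) \<and>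
        (\<forall>v. (v = u \<longrightarrow> u \<notin> set vs \<longrightarrow> \<tau> u = a) \<and> (v \<noteq> u \<longrightarrow> v \<notin> set vs \<longrightarrow> \<tau> v = \<sigma> v))"
      \<comment> \<open>If \<open>u\<close> recurs in \<open>vs\<close>, then
        \<open>\<tau> u\<close> may differ from \<open>a\<close> but lies in \<open>S\<close>
        anyway; otherwise it equals \<open>a\<close>.\<close>
      then have "(\<forall>v\<in>set (u # vs). \<tau> v \<in> S) \<and> (\<forall>v. v \<notin> set (u # vs) \<longrightarrow> \<tau> v = \<sigma> v)" by auto
      with r show "sat_rel \<B> S \<tau> \<phi>" by blast
    qed
  qed
qed

lemma admits_simple_A_she_if_collapsible:
  fixes \<B> :: "('r, 'a) rel_struct"
  assumes fin: "finite_structure \<B>" and x: "x \<in> universe \<B>"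
    and coll: "zero_collapsible \<B> {x} (eqfree_pH_sentences \<B>)"
  shows "admits_simple_A_she \<B>"
proof (rule ccontr)
  assume none: "\<not> admits_simple_A_she \<B>"
  define B where "B = universe \<B>"
  define F where "F g a = (if a = x then B else {g a})" for g and a :: 'a
  \<comment> \<open>Extensional functions keep \<open>G\<close> finite; two of them that differ only
    at \<open>x\<close> give the same shop.\<close>
  define G where "G = B \<rightarrow>\<^sub>E B"
  have finB: "finite B" and xB: "x \<in> B" using fin x by (auto simp: finite_structure_def B_def)
  have finG: "finite G" unfolding G_def using finB by (simp add: finite_PiE)
  have "\<exists>R as bs. R \<in> symbols \<B> \<and> as \<in> interp \<B> R \<and> list_all2 (\<lambda>a b. b \<in> F g a) as bs \<and> bs \<notin> interp \<B> R"
    if "g \<in> G" for g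
  proof -
    have "simple_A_shop B (F g)"
      using that xB unfolding simple_A_shop_def shop_def F_def G_def by auto
    with none have "\<not> she \<B> (F g)" "shop B (F g)"
      unfolding admits_simple_A_she_def simple_A_shop_def B_def by blast+
    then show ?thesis unfolding she_def B_def by blast
  qed
  then obtain R as bs where viol: "\<And>g. g \<in> G \<Longrightarrow> R g \<in> symbols \<B> \<and> as g \<in> interp \<B> (R g) \<and>
      list_all2 (\<lambda>a b. b \<in> F g a) (as g) (bs g) \<and> bs g \<notin> interp \<B> (R g)"
    by metis
  have len: "length (as g) = arity \<B> (R g)" "length (bs g) = arity \<B> (R g)"
    and as_B: "set (as g) \<subseteq> B" if "g \<in> G" for g
    using viol[OF that] fin unfolding finite_structure_def B_def by (auto dest: list_all2_lengthD)
  have bs_F: "bs g ! i \<in> F g (as g ! i)" if "g \<in> G" "i < arity \<B> (R g)" for g i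
    using viol[OF that(1)] len[OF that(1)] that(2) by (auto simp: list_all2_conv_all_nth)
  have as_nth: "as g ! i \<in> B" if "g \<in> G" "i < arity \<B> (R g)" for g i
    using as_B[OF that(1)] len[OF that(1)] that(2) by (auto simp: subset_iff)
  have bs_nth: "bs g ! i \<in> B" if "g \<in> G" "i < arity \<B> (R g)" for g i
    using bs_F[OF that] as_nth[OF that] that(1) xB unfolding F_def G_def by (auto split: if_splits)
  obtain h :: "'a \<Rightarrow> nat" where h: "inj_on h B"
    using finB finite_imp_inj_to_nat_seg by metis
  \<comment> \<open>Even numbers code the \<open>V a\<close> and odd ones the \<open>W b\<close>;
    \<open>n div 2\<close> drops the parity, so the single map \<open>e\<close> decodes
    both.\<close>
  define e where "e n = the_inv_into B h (n div 2)" for n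
  define V W where "V a = 2 * h a" and "W b = Suc (2 * h b)" for a b
  have e: "e (V a) = a" "e (W a) = a" if "a \<in> B" for a
    using that h by (auto simp: e_def V_def W_def the_inv_into_f_f)
  have VW: "V a \<noteq> W b" for a b unfolding V_def W_def by presburger
  \<comment> \<open>The variables \<open>V a\<close> are shared by the atoms of all
    \<open>g\<close>, so that one assignment to them describes a single function on
    \<open>B\<close>.\<close>
  define at where "at g = Atom (R g) (map2 (\<lambda>a b. if a = x then W b else V a) (as g) (bs g))" for g
  \<comment> \<open>The identity shows that there is at least one atom to conjoin.\<close>
  have "x \<in> B \<Longrightarrow> restrict (\<lambda>a. a) B \<in> G" by (simp add: G_def)
  with xB have "G \<noteq> {}" by auto
  have at_ok: "conj_of_atoms (at g) \<and> over_signature \<B> (at g)" if "g \<in> G" for g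
    using viol[OF that] len[OF that] by (simp add: at_def)
  have at_free: "free_vars (at g) \<subseteq> V ` B \<union> W ` B" if "g \<in> G" for g
    using len[OF that] as_nth[OF that] bs_nth[OF that]
    by (auto simp: at_def set_zip split: if_splits)
  have atG: "finite (at ` G)" "at ` G \<noteq> {}"
    "\<And>\<psi>. \<psi> \<in> at ` G \<Longrightarrow> conj_of_atoms \<psi> \<and> over_signature \<B> \<psi>"
    using finG \<open>G \<noteq> {}\<close> at_ok by auto
  obtain \<phi> where \<phi>: "conj_of_atoms \<phi>" "over_signature \<B> \<phi>" "free_vars \<phi> = \<Union> (free_vars ` at ` G)"
    "\<And>S \<sigma>. sat_rel \<B> S \<sigma> \<phi> \<longleftrightarrow> (\<forall>\<psi>\<in>at ` G. sat_rel \<B> S \<sigma> \<psi>)"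
    using exists_finite_conj[OF atG(1,2), of \<B>] atG(3) by blast
  obtain vs ws where vs: "set vs = V ` B" and ws: "set ws = W ` B"
    using finB by (metis finite_imageI finite_list)
  define \<theta> where "\<theta> = foldr Exi vs (foldr Uni ws \<phi>)"
  have "\<theta> \<in> eqfree_pH_sentences \<B>"
    using \<phi>(1-3) at_free vs ws
    by (auto simp: eqfree_pH_sentences_def \<theta>_def prenex_pH_if_conj_of_atoms)
  moreover have "models_rel \<B> {x} \<theta>"
    unfolding models_rel_def
  proof
    fix \<sigma>
    define \<tau> where "\<tau> n = (if n \<in> V ` B then e n else \<sigma> n)" for n
    have "sat_rel \<B> {x} \<tau>' (at g)"
      if "g \<in> G" and \<tau>': "\<forall>v\<in>set ws. \<tau>' v \<in> {x}" "\<forall>v. v \<notin> set ws \<longrightarrow> \<tau>' v = \<tau> v" for \<tau>' g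
    proof -
      have "V b \<notin> set ws" for b using VW ws by auto
      then have "\<tau>' (W b) = x" "\<tau>' (V b) = b" if "b \<in> B" for b
        using \<tau>' that ws e(1)[OF that] by (simp_all add: \<tau>_def)
      \<comment> \<open>Where \<open>as g\<close> has the entry \<open>x\<close>, the variable
        \<open>W b\<close> is forced to \<open>x\<close>; elsewhere \<open>V a\<close> has value
        \<open>a\<close>. The atom thus reads \<open>as g\<close>.\<close>
      then have "map \<tau>' (map2 (\<lambda>a b. if a = x then W b else V a) (as g) (bs g)) = as g"
        using len[OF \<open>g \<in> G\<close>] as_nth[OF \<open>g \<in> G\<close>] bs_nth[OF \<open>g \<in> G\<close>]
        by (intro nth_equalityI) auto
      with viol[OF \<open>g \<in> G\<close>] show ?thesis by (simp only: at_def sat_rel.simps)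
    qed
    then have "sat_rel \<B> {x} \<tau> (foldr Uni ws \<phi>)"
      using \<phi>(4) by (auto simp: sat_rel_foldr_Uni)
    then show "sat_rel \<B> {x} \<sigma> \<theta>"
      unfolding \<theta>_def sat_rel_foldr_Exi vs using e
      by (intro exI[of _ \<tau>]) (auto simp: \<tau>_def B_def)
  qed
  ultimately have "models_rel \<B> B \<theta>"
    using coll unfolding zero_collapsible_def models_def B_def by blast
  then have "sat_rel \<B> B e \<theta>" by (simp add: models_rel_def)
  then obtain \<tau> where \<tau>: "\<forall>v\<in>V ` B. \<tau> v \<in> B" "sat_rel \<B> B \<tau> (foldr Uni ws \<phi>)"
    unfolding \<theta>_def sat_rel_foldr_Exi vs B_def by blast
  \<comment> \<open>This \<open>g\<close> is known only now, but its atom is a conjunct of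
    \<open>\<phi>\<close>, which ranges over all of \<open>G\<close>.\<close>
  define g where "g = restrict (\<tau> \<circ> V) B"
  have g: "g \<in> G" using \<tau>(1) by (auto simp: g_def G_def)
  \<comment> \<open>Universal variables now range over all of \<open>B\<close>, so each
    \<open>W b\<close> may be given the value \<open>b\<close>.\<close>
  define \<tau>' where "\<tau>' n = (if n \<in> W ` B then e n else \<tau> n)" for n
  have "(\<forall>v\<in>set ws. \<tau>' v \<in> B) \<and> (\<forall>v. v \<notin> set ws \<longrightarrow> \<tau>' v = \<tau> v)"
    using e ws by (auto simp: \<tau>'_def)
  with \<tau>(2) have "sat_rel \<B> B \<tau>' \<phi>"
    unfolding sat_rel_foldr_Uni by blast
  with \<phi>(4) g have "sat_rel \<B> B \<tau>' (at g)" by blast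
  \<comment> \<open>Away from \<open>x\<close> the shop \<open>F g\<close> has singleton values, so
    these entries of \<open>bs g\<close> are determined by \<open>g\<close>.\<close>
  have "g (as g ! i) = bs g ! i" if "i < arity \<B> (R g)" "as g ! i \<noteq> x" for i
    using bs_F[OF g that(1)] that(2) by (simp add: F_def)
  moreover have "\<tau>' (W b) = b" "\<tau>' (V b) = g b" if "b \<in> B" for b
    using that e VW by (auto simp: \<tau>'_def g_def)
  ultimately have "map \<tau>' (map2 (\<lambda>a b. if a = x then W b else V a) (as g) (bs g)) = bs g"
    using len[OF g] as_nth[OF g] bs_nth[OF g] by (intro nth_equalityI) auto
  with \<open>sat_rel \<B> B \<tau>' (at g)\<close> have "bs g \<in> interp \<B> (R g)" by (simp only: at_def sat_rel.simps)
  with viol[OF g] show False by blast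
qed

theorem theorem9:
  fixes \<B> :: "('r, 'a) rel_struct"
  assumes "finite_structure \<B>"
  shows "((\<exists>x\<in>universe \<B>. zero_collapsible \<B> {x} (eqfree_pH_sentences \<B>))
            \<longleftrightarrow> admits_simple_A_she \<B>)
       \<and> (admits_simple_A_she \<B>
            \<longleftrightarrow> (\<exists>x\<in>universe \<B>. zero_collapsible \<B> {x} (positive_eqfree_sentences \<B>)))"
proof -
  have "\<exists>x\<in>universe \<B>. zero_collapsible \<B> {x} (positive_eqfree_sentences \<B>)"
    if "admits_simple_A_she \<B>"
    using that zero_collapsible_positive_eqfree
    unfolding admits_simple_A_she_def simple_A_shop_def by metis
  \<comment> \<open>This closes the cycle: every pH-sentence is a positive sentence.\<close>
  moreover have "\<exists>x\<in>universe \<B>. zero_collapsible \<B> {x} (eqfree_pH_sentences \<B>)"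
    if "\<exists>x\<in>universe \<B>. zero_collapsible \<B> {x} (positive_eqfree_sentences \<B>)"
    using that zero_collapsible_subset eqfree_pH_subset_positive_eqfree by metis
  ultimately show ?thesis
    using admits_simple_A_she_if_collapsible[OF assms] by blast
qed

end
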